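(* Let $(X,\mathcal{C})$ be any category base and let $A\subseteq X$. Then $A$ is non-Baire if and only if $A$ satisfies the $(\star)$-property, i.e. if and only if there exists a region $C\in\mathcal{C}$ such that for every subregion $D$ of $C$ and every set $E\subseteq X$ which essentially contains $D$, the set $A\cap E$ is non-Baire.
   Context: A category base is a pair $(X,\mathcal{C})$ where $X$ is a non-empty set and $\mathcal{C}$ is a family of subsets of $X$, called regions, satisfying the following axioms. (1) Every point of $X$ belongs to some region, i.e. $X=\bigcup\mathcal{C}$. (2) Let $A$ be a region and $\mathcal{D}$ a non-empty family of disjoint regions having cardinality less than the cardinality of $\mathcal{C}$. (i) If $A\cap(\bigcup\mathcal{D})$ contains a region, then there is a region $D\in\mathcal{D}$ such that $A\cap D$ contains a region. (ii) If $A\cap(\bigcup\mathcal{D})$ contains no region, then there is a region $B\subseteq A$ that is disjoint from every region in $\mathcal{D}$. A subregion of a region $C$ is a region contained in $C$. A set is singular if every region contains a subregion which is disjoint from the set. A set is meager if it can be expressed as a countable union of singular sets; otherwise it is abundant. A set $S\subseteq X$ is meager (abundant) in a region $D$ if $S\cap D$ is meager (abundant). A set $S\subseteq X$ is Baire if in every region there is a subregion in which either $S$ or its complement $X-S$ is meager; a set is non-Baire if it is not Baire. A set $E$ essentially contains $D$ if $D-E$ is meager. *)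

theory Defs
  imports Main "HOL-Library.Countable_Set" "HOL-Library.Equipollence"
begin

(* The empty set is not excluded as a region; a region is any member of C. *)
locale category_base =
  fixes X :: "'a set" and C :: "'a set set"
  assumes space_nonempty: "X \<noteq> {}"
    and regions_subset: "\<And>A. A \<in> C \<Longrightarrow> A \<subseteq> X"
    and regions_cover: "X = \<Union>C"
    and contains_region:
      "\<And>A \<D>. \<lbrakk>A \<in> C; \<D> \<noteq> {}; \<D> \<subseteq> C; pairwise disjnt \<D>; \<D> \<prec> C;
         \<exists>B\<in>C. B \<subseteq> A \<inter> \<Union>\<D>\<rbrakk> \<Longrightarrow> \<exists>D\<in>\<D>. \<exists>B\<in>C. B \<subseteq> A \<inter> D"
    and contains_no_region:
      "\<And>A \<D>. \<lbrakk>A \<in> C; \<D> \<noteq> {}; \<D> \<subseteq> C; pairwise disjnt \<D>; \<D> \<prec> C;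
         \<not> (\<exists>B\<in>C. B \<subseteq> A \<inter> \<Union>\<D>)\<rbrakk> \<Longrightarrow> \<exists>B\<in>C. B \<subseteq> A \<and> (\<forall>D\<in>\<D>. disjnt B D)"

definition subregion :: "'a set set \<Rightarrow> 'a set \<Rightarrow> 'a set \<Rightarrow> bool" where
  "subregion C D R \<longleftrightarrow> D \<in> C \<and> D \<subseteq> R"

definition singular :: "'a set \<Rightarrow> 'a set set \<Rightarrow> 'a set \<Rightarrow> bool" where
  "singular X C S \<longleftrightarrow> S \<subseteq> X \<and> (\<forall>R\<in>C. \<exists>D. subregion C D R \<and> disjnt D S)"

definition meager :: "'a set \<Rightarrow> 'a set set \<Rightarrow> 'a set \<Rightarrow> bool" where
  "meager X C S \<longleftrightarrow> (\<exists>\<F>. countable \<F> \<and> (\<forall>T\<in>\<F>. singular X C T) \<and> S = \<Union>\<F>)"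

definition meager_in :: "'a set \<Rightarrow> 'a set set \<Rightarrow> 'a set \<Rightarrow> 'a set \<Rightarrow> bool" where
  "meager_in X C S D \<longleftrightarrow> meager X C (S \<inter> D)"

definition baire :: "'a set \<Rightarrow> 'a set set \<Rightarrow> 'a set \<Rightarrow> bool" where
  "baire X C S \<longleftrightarrow> S \<subseteq> X \<and>
     (\<forall>R\<in>C. \<exists>D. subregion C D R \<and> (meager_in X C S D \<or> meager_in X C (X - S) D))"

(* Being a subset of X is required here too, so that subsets of the ambient type
   that are not contained in X are neither Baire nor non-Baire. *)
definition non_baire :: "'a set \<Rightarrow> 'a set set \<Rightarrow> 'a set \<Rightarrow> bool" where
  "non_baire X C S \<longleftrightarrow> S \<subseteq> X \<and> \<not> baire X C S"

definition essentially_contains :: "'a set \<Rightarrow> 'a set set \<Rightarrow> 'a set \<Rightarrow> 'a set \<Rightarrow> bool" where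
  "essentially_contains X C E D \<longleftrightarrow> meager X C (D - E)"

definition star_property :: "'a set \<Rightarrow> 'a set set \<Rightarrow> 'a set \<Rightarrow> bool" where
  "star_property X C A \<longleftrightarrow>
     (\<exists>R\<in>C. \<forall>D E. subregion C D R \<longrightarrow> E \<subseteq> X \<longrightarrow> essentially_contains X C E D \<longrightarrow>
        non_baire X C (A \<inter> E))"

end

theory Submission
  imports Defs
begin

text \<open>
  If \<open>A\<close> is non-Baire, some region \<open>R\<close> has both \<open>A\<close> and \<open>X - A\<close> abundant in each of its subregions.
  This \<open>R\<close> witnesses the star property: if \<open>D - E\<close> is meager and \<open>A \<inter> E\<close> is meager (or comeager) in
  a subregion of \<open>D\<close>, then so is \<open>A\<close>, as \<open>A\<close> and \<open>A \<inter> E\<close> differ by a meager set inside \<open>D\<close>.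
  Conversely take \<open>D = R\<close> and \<open>E = X\<close>.
\<close>

lemma singular_subset: "singular X C S \<Longrightarrow> T \<subseteq> S \<Longrightarrow> singular X C T"
  unfolding singular_def disjnt_def by blast

text \<open>Intersecting every member of the countable family with \<open>T\<close> keeps it
  countable and its members singular, since singularity passes to subsets.\<close>

lemma meager_subset:
  assumes "meager X C S" and "T \<subseteq> S"
  shows "meager X C T"
proof -
  obtain \<F> where "countable \<F>" and "\<forall>U\<in>\<F>. singular X C U" and "S = \<Union>\<F>"
    using assms(1) unfolding meager_def by blast
  then have "countable ((\<inter>) T ` \<F>)" "\<forall>U\<in>(\<inter>) T ` \<F>. singular X C U" "T = \<Union>((\<inter>) T ` \<F>)"
    using assms(2) by (auto intro: singular_subset)
  then show ?thesis
    unfolding meager_def by blast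
qed

lemma meager_Un:
  assumes "meager X C S" and "meager X C T"
  shows "meager X C (S \<union> T)"
proof -
  obtain \<F> \<G> where "countable \<F>" "\<forall>U\<in>\<F>. singular X C U" "S = \<Union>\<F>"
    and "countable \<G>" "\<forall>U\<in>\<G>. singular X C U" "T = \<Union>\<G>"
    using assms unfolding meager_def by blast
  then have "countable (\<F> \<union> \<G>)" "\<forall>U\<in>\<F> \<union> \<G>. singular X C U" "S \<union> T = \<Union>(\<F> \<union> \<G>)"
    by auto
  then show ?thesis
    unfolding meager_def by blast
qed

lemma meager_empty: "meager X C {}"
  unfolding meager_def by (rule exI[of _ "{}"]) simp

lemma non_baire_imp_star_property:
  assumes "non_baire X C A"
  shows "star_property X C A"
proof -
  have "A \<subseteq> X"
    using assms by (simp add: non_baire_def)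
  \<comment> \<open>As \<open>A \<subseteq> X\<close>, being non-Baire means that the clause of
    \<open>baire\<close> on regions fails at some \<open>R\<close>.\<close>
  obtain R where "R \<in> C" and abundant:
    "\<And>D. subregion C D R \<Longrightarrow> \<not> meager X C (A \<inter> D) \<and> \<not> meager X C ((X - A) \<inter> D)"
    using assms unfolding non_baire_def baire_def meager_in_def by blast
  have "non_baire X C (A \<inter> E)"
    if "subregion C D R" "E \<subseteq> X" and ess: "essentially_contains X C E D" for D E
  proof -
    have "\<not> baire X C (A \<inter> E)"
    proof
      assume "baire X C (A \<inter> E)"
      moreover have "D \<in> C"
        using that(1) by (simp add: subregion_def)
      ultimately obtain D' where "subregion C D' D" and D':
        "meager X C (A \<inter> E \<inter> D') \<or> meager X C ((X - A \<inter> E) \<inter> D')"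
        unfolding baire_def meager_in_def by blast
      \<comment> \<open>\<open>abundant\<close> covers all subregions of \<open>R\<close>, hence
        also the \<open>D'\<close> found inside \<open>D\<close>.\<close>
      then have "subregion C D' R" and "D' \<subseteq> D"
        using that(1) unfolding subregion_def by blast+
      from D' show False
      proof
        assume "meager X C (A \<inter> E \<inter> D')"
        \<comment> \<open>A point of \<open>A \<inter> D'\<close> outside \<open>E\<close> lies in
          \<open>D - E\<close>, so this union covers \<open>A \<inter> D'\<close>.\<close>
        then have "meager X C ((A \<inter> E \<inter> D') \<union> (D - E))"
          using ess unfolding essentially_contains_def by (rule meager_Un)
        then have "meager X C (A \<inter> D')"
          using \<open>D' \<subseteq> D\<close> by (elim meager_subset) blast
        then show False
          using abundant \<open>subregion C D' R\<close> by blast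
      next
        assume "meager X C ((X - A \<inter> E) \<inter> D')"
        \<comment> \<open>Complements reverse inclusion: \<open>X - A\<close> lies in
          \<open>X - A \<inter> E\<close>.\<close>
        then have "meager X C ((X - A) \<inter> D')"
          by (rule meager_subset) blast
        then show False
          using abundant \<open>subregion C D' R\<close> by blast
      qed
    qed
    then show ?thesis
      using \<open>A \<subseteq> X\<close> by (auto simp: non_baire_def)
  qed
  then show ?thesis
    using \<open>R \<in> C\<close> unfolding star_property_def by blast
qed

lemma star_property_imp_non_baire:
  assumes "\<And>R. R \<in> C \<Longrightarrow> R \<subseteq> X" and "A \<subseteq> X" and "star_property X C A"
  shows "non_baire X C A"
proof -
  obtain R where "R \<in> C" and star:
    "\<And>D E. \<lbrakk>subregion C D R; E \<subseteq> X; essentially_contains X C E D\<rbrakk> \<Longrightarrow> non_baire X C (A \<inter> E)"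
    using assms(3) unfolding star_property_def by blast
  \<comment> \<open>Regions lie in \<open>X\<close>, so \<open>E = X\<close> is admissible for
    \<open>D = R\<close>, and \<open>A \<inter> X\<close> is \<open>A\<close> itself.\<close>
  have "R - X = {}"
    using assms(1) \<open>R \<in> C\<close> by blast
  then have "essentially_contains X C X R"
    by (simp only: essentially_contains_def meager_empty)
  then have "non_baire X C (A \<inter> X)"
    using star[of R X] \<open>R \<in> C\<close> by (simp add: subregion_def)
  then show ?thesis
    using \<open>A \<subseteq> X\<close> by (simp add: Int_absorb2)
qed

theorem theorem7:
  fixes X :: "'a set" and C :: "'a set set" and A :: "'a set"
  assumes "category_base X C"
    and "A \<subseteq> X"
  shows "non_baire X C A \<longleftrightarrow> star_property X C A"
  using non_baire_imp_star_property star_property_imp_non_baire assms(2)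
    category_base.regions_subset[OF assms(1)] by metis

end
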